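(* Let $A\subset\mathbb{N}$ be finite and let $n\in\mathbb{N}$ be a practical number such that $S(n)\subset A$ and $n\notin A$. If every element of $A\setminus S(n)$ is at most $s(n)+1$, then $an\in\Pr(A)$ for every $a\in\mathbb{N}$. In particular, $\Pr(A\cup\{n\})=\Pr(A)$.
   Context: For $n\in\mathbb{N}$, $D(n)$ is the set of positive divisors of $n$, $S(n)=D(n)\setminus\{n\}$ is the set of proper divisors, $\sigma(n)=\sum_{d\in D(n)}d$ and $s(n)=\sigma(n)-n$. For $A\subset\mathbb{N}$, $S_A=\sum_{a\in A}a$ ($S_\emptyset=0$), and $A$ is a practical set if every non-negative integer $k\le S_A$ is a sum of distinct elements of $A$. A number $m\in\mathbb{N}$ is $A$-practical if $D(m)\cap A$ is a practical set, and $\Pr(A)$ is the set of all $A$-practical numbers. A positive integer $n$ is a practical number if $D(n)$ is a practical set. *)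

theory Defs
  imports Complex_Main
begin

text \<open>
  Throughout, the positive integers are the positive elements of type \<^typ>\<open>nat\<close>;
  positivity is stated explicitly where it is needed.
\<close>

definition divs :: "nat \<Rightarrow> nat set" where
  "divs n = {d. d > 0 \<and> d dvd n}"

definition proper_divs :: "nat \<Rightarrow> nat set" where
  "proper_divs n = divs n - {n}"

definition sigma :: "nat \<Rightarrow> nat" where
  "sigma n = (\<Sum>d\<in>divs n. d)"

text \<open>The subtraction does not truncate for \<open>n > 0\<close>, as \<open>n\<close> is one of its own divisors.\<close>

definition aliquot :: "nat \<Rightarrow> nat" where
  "aliquot n = sigma n - n"

text \<open>
  For an infinite set of positive integers the element sum is infinite and so bounds
  every \<open>k\<close>, whereas the library sum over an infinite set is \<open>0\<close>. The bound is
  therefore imposed only when \<open>A\<close> is finite.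
\<close>

definition practical_set :: "nat set \<Rightarrow> bool" where
  "practical_set A \<longleftrightarrow>
     (\<forall>k. (finite A \<longrightarrow> k \<le> \<Sum>A) \<longrightarrow> (\<exists>B. finite B \<and> B \<subseteq> A \<and> \<Sum>B = k))"

definition set_practical :: "nat set \<Rightarrow> nat \<Rightarrow> bool" where
  "set_practical A m \<longleftrightarrow> m > 0 \<and> practical_set (divs m \<inter> A)"

definition Pr :: "nat set \<Rightarrow> nat set" where
  "Pr A = {m. set_practical A m}"

definition practical_number :: "nat \<Rightarrow> bool" where
  "practical_number n \<longleftrightarrow> n > 0 \<and> practical_set (divs n)"

end

theory Submission
  imports Defs
begin

text \<open>
  A finite set is practical iff each of its elements exceeds the sum of the smaller ones by at
  most 1. Hence deleting the largest divisor \<open>n\<close> from the practical set of divisors of \<open>n\<close> leaves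
  a practical set \<open>S(n)\<close> of sum \<open>s(n) \<ge> n - 1\<close>, and a practical set remains practical
  when one adds elements bounded by its sum plus 1.
\<close>

lemma practical_set_finite_iff:
  assumes "finite E"
  shows "practical_set E \<longleftrightarrow> (\<forall>k\<le>\<Sum>E. \<exists>B\<subseteq>E. \<Sum>B = k)"
  using assms by (auto simp: practical_set_def dest: finite_subset)

lemma practical_setE:
  assumes "finite E" "practical_set E" "k \<le> \<Sum>E"
  obtains B where "B \<subseteq> E" "\<Sum>B = k"
  using assms by (auto simp: practical_set_def)

text \<open>Sums avoiding \<open>x\<close> cover 0 up to \<open>\<Sum>F\<close>, and sums using
  \<open>x\<close> cover \<open>x\<close> up to \<open>x + \<Sum>F\<close>; the bound on
  \<open>x\<close> leaves no gap between the two ranges.\<close>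

lemma practical_set_insert:
  assumes "finite F" "practical_set F" "x \<le> \<Sum>F + 1"
  shows "practical_set (insert x F)"
proof (cases "x \<in> F")
  case True
  then show ?thesis using assms(2) by (simp add: insert_absorb)
next
  case False
  have "\<exists>B\<subseteq>insert x F. \<Sum>B = k" if k: "k \<le> \<Sum>(insert x F)" for k
  proof (cases "k \<le> \<Sum>F")
    case True
    then obtain B where "B \<subseteq> F" "\<Sum>B = k"
      using assms(1,2) practical_setE by blast
    then show ?thesis by blast
  next
    case gt: False
    have "k - x \<le> \<Sum>F"
      using k False assms(1) by simp
    then obtain B where B: "B \<subseteq> F" "\<Sum>B = k - x"
      using assms(1,2) practical_setE by blast
    then have "\<Sum>(insert x B) = x + (k - x)"
      using False assms(1) by (subst sum.insert) (auto intro: finite_subset)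
    \<comment> \<open>Here \<open>k\<close> is at least \<open>\<Sum>F + 1\<close>, so
      \<open>k - x\<close> does not truncate and \<open>x + (k - x)\<close> is
      \<open>k\<close>.\<close>
    moreover have "x \<le> k"
      using gt assms(3) by simp
    ultimately show ?thesis
      using B(1) by (intro exI[of _ "insert x B"]) auto
  qed
  then show ?thesis
    using assms(1) by (simp add: practical_set_finite_iff)
qed

text \<open>The new elements can be inserted one at a time in any order: the sum only grows along
  the way, so a bound by \<open>\<Sum>F + 1\<close> stays sufficient.\<close>

lemma practical_set_extend:
  assumes "finite G" "F \<subseteq> G" "practical_set F" "\<And>x. x \<in> G - F \<Longrightarrow> x \<le> \<Sum>F + 1"
  shows "practical_set G"
proof -
  have fin: "finite F"
    using assms(1,2) finite_subset by blast
  have "practical_set (H \<union> F)" if "finite H" "H \<subseteq> G - F" for H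
    using that
  proof (induction H rule: finite_induct)
    case empty
    then show ?case using assms(3) by simp
  next
    case (insert x H)
    have "\<Sum>F \<le> \<Sum>(H \<union> F)"
      using fin insert.hyps by (intro sum_mono2) auto
    then have "x \<le> \<Sum>(H \<union> F) + 1"
      using assms(4)[of x] insert.prems by force
    then show ?case
      using practical_set_insert[of "H \<union> F" x] fin insert by auto
  qed
  from this[of "G - F"] show ?thesis
    using assms(1,2) by (simp add: Un_absorb2)
qed

text \<open>For positive \<open>x\<close>, a representation of \<open>x - 1\<close> can only use
  elements below \<open>x\<close>, so these sum to at least \<open>x - 1\<close>.\<close>

lemma practical_set_imp_le:
  assumes "finite E" "practical_set E" "x \<in> E"
  shows "x \<le> \<Sum>{y\<in>E. y < x} + 1"
proof (cases "x = 0")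
  case False
  have "x \<le> \<Sum>E"
    using assms(1,3) member_le_sum[of x E "\<lambda>x. x"] by simp
  then have "x - 1 \<le> \<Sum>E"
    by simp
  then obtain B where B: "B \<subseteq> E" "\<Sum>B = x - 1"
    using assms(1,2) practical_setE by blast
  then have "finite B"
    using assms(1) finite_subset by blast
  then have "y \<le> x - 1" if "y \<in> B" for y
    using that B(2) member_le_sum[of y B "\<lambda>x. x"] by simp
  then have "B \<subseteq> {y\<in>E. y < x}"
    using B(1) False by fastforce
  then have "\<Sum>B \<le> \<Sum>{y\<in>E. y < x}"
    using assms(1) by (intro sum_mono2) auto
  then show ?thesis
    using B(2) by simp
qed simp

text \<open>Building \<open>E\<close> in increasing order, each new maximum \<open>b\<close> leaves
  the condition at earlier elements untouched, and the condition at \<open>b\<close> is what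
  insertion requires.\<close>

lemma le_imp_practical_set:
  fixes E :: "nat set"
  assumes "finite E" "\<And>x. x \<in> E \<Longrightarrow> x \<le> \<Sum>{y\<in>E. y < x} + 1"
  shows "practical_set E"
  using assms
proof (induction E rule: finite_linorder_max_induct)
  case empty
  then show ?case by (simp add: practical_set_def)
next
  case (insert b E)
  have "x \<le> \<Sum>{y\<in>E. y < x} + 1" if "x \<in> E" for x
  proof -
    have "{y\<in>insert b E. y < x} = {y\<in>E. y < x}"
      using insert.hyps(2) that by force
    then show ?thesis
      using insert.prems[of x] that by simp
  qed
  then have "practical_set E"
    by (rule insert.IH)
  moreover have "{y\<in>insert b E. y < b} = E"
    using insert.hyps(2) by force
  then have "b \<le> \<Sum>E + 1"
    using insert.prems[of b] by simp
  ultimately show ?case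
    using practical_set_insert insert.hyps(1) by blast
qed

text \<open>The criterion at \<open>x\<close> involves only elements below \<open>x\<close>, so it
  survives cutting off everything from \<open>c\<close> on.\<close>

lemma practical_set_less:
  assumes "finite E" "practical_set E"
  shows "practical_set {y\<in>E. y < c}"
proof (rule le_imp_practical_set)
  fix x assume x: "x \<in> {y\<in>E. y < c}"
  then have "{y\<in>{y\<in>E. y < c}. y < x} = {y\<in>E. y < x}"
    by auto
  then show "x \<le> \<Sum>{y\<in>{y\<in>E. y < c}. y < x} + 1"
    using practical_set_imp_le[OF assms, of x] x by simp
qed (use assms(1) in simp)

lemma finite_divs: "n > 0 \<Longrightarrow> finite (divs n)"
  by (simp add: divs_def)

lemma proper_divs_eq: "n > 0 \<Longrightarrow> proper_divs n = {y\<in>divs n. y < n}"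
  by (auto simp: proper_divs_def divs_def dest: dvd_imp_le)

lemma aliquot_eq_sum_proper_divs:
  assumes "n > 0"
  shows "aliquot n = \<Sum>(proper_divs n)"
proof -
  have "n \<in> divs n"
    using assms by (simp add: divs_def)
  then show ?thesis
    using finite_divs[OF assms] by (simp add: aliquot_def sigma_def proper_divs_def sum_diff1_nat)
qed

theorem theorem3p23:
  fixes A :: "nat set" and n :: nat
  assumes "A \<subseteq> {0<..}"
    and "finite A"
    and "n > 0"
    and "practical_number n"
    and "proper_divs n \<subseteq> A"
    and "n \<notin> A"
    and "\<forall>x \<in> A - proper_divs n. x \<le> aliquot n + 1"
  shows "(\<forall>a>0. a * n \<in> Pr A) \<and> Pr (A \<union> {n}) = Pr A"
proof -
  have D: "finite (divs n)" "practical_set (divs n)"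
    using assms(3,4) finite_divs by (auto simp: practical_number_def)
  have S: "practical_set (proper_divs n)"
    using practical_set_less[OF D] proper_divs_eq[OF assms(3)] by simp
  \<comment> \<open>The criterion at the largest divisor \<open>n\<close>. It lets \<open>n\<close>
    itself be inserted like the elements of \<open>A\<close> outside
    \<open>proper_divs n\<close>.\<close>
  have n_le: "n \<le> \<Sum>(proper_divs n) + 1"
    using practical_set_imp_le[OF D, of n] proper_divs_eq[OF assms(3)] assms(3)
    by (simp add: divs_def)
  \<comment> \<open>Leaving \<open>B\<close> between \<open>A\<close> and \<open>insert n A\<close>
    treats both sets of the final equality at once.\<close>
  have multiple: "a * n \<in> Pr B" if "a > 0" "A \<subseteq> B" "B \<subseteq> insert n A" for a B
  proof -
    have sub: "proper_divs n \<subseteq> divs (a * n) \<inter> B"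
      using assms(5) that by (auto simp: proper_divs_def divs_def)
    have "practical_set (divs (a * n) \<inter> B)"
    proof (rule practical_set_extend[OF _ sub S])
      show "finite (divs (a * n) \<inter> B)"
        using finite_divs that(1) assms(3) by simp
      show "x \<le> \<Sum>(proper_divs n) + 1" if "x \<in> divs (a * n) \<inter> B - proper_divs n" for x
        using that \<open>B \<subseteq> insert n A\<close> assms(7) n_le
        by (auto simp: aliquot_eq_sum_proper_divs[OF assms(3)])
    qed
    then show ?thesis
      using that(1) assms(3) by (simp add: Pr_def set_practical_def)
  qed
  have "m \<in> Pr (A \<union> {n}) \<longleftrightarrow> m \<in> Pr A" for m
  proof (cases "n dvd m \<and> m > 0")
    case True
    then obtain a where "m = a * n" "a > 0"
      by (auto simp: dvd_def mult.commute)
    then show ?thesis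
      using multiple[of a A] multiple[of a "A \<union> {n}"] by auto
  next
    case False
    \<comment> \<open>If \<open>n\<close> does not divide \<open>m\<close>, adjoining
      \<open>n\<close> does not change the intersection; 0 lies in neither set because
      \<open>set_practical\<close> demands positivity.\<close>
    then have "m = 0 \<or> divs m \<inter> (A \<union> {n}) = divs m \<inter> A"
      by (auto simp: divs_def)
    then show ?thesis
      by (auto simp: Pr_def set_practical_def)
  qed
  then show ?thesis
    using multiple by blast
qed

end
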